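(* Let $m$ be an odd positive integer, $\sigma=2^{(m+1)/2}$, and let $f(x)=x^{-\frac{\sigma}{2}}+x^{-\frac{\sigma-1}{2}}+x$. Then $f$ is a $(0,1,4)$-map on $\mathbb{F}_{2^m}^*$, $(D(f)^* )^{\sigma+1}=T_1$, and hence $|D(f)^*|=2^{m-1}$.
   Context: $f$ is regarded as a function $\mathbb{F}_{2^m}^*\to\mathbb{F}_{2^m}$; half-integer exponents are meaningful because squaring is a bijection of $\mathbb{F}_{2^m}$ ($x^{1/2}$ is the unique square root $x^{2^{m-1}}$ of $x$). A function $F:X\to Y$ is called a $(0,1,a)$-map if for every $y\in Y$ the number of $x\in X$ with $F(x)=y$ belongs to $\{0,1,a\}$. $D(f)^*=\{f(x):x\in\mathbb{F}_{2^m}^*\}\setminus\{0\}$. For a subset $\mathcal{D}$ of $\mathbb{F}_{2^m}^*$, $\mathcal{D}^k=\{d^k:d\in\mathcal{D}\}$. $T_1=\{x\in\mathbb{F}_{2^m}:\mathrm{Tr}(x)=1\}$, where $\mathrm{Tr}$ is the absolute trace $\mathbb{F}_{2^m}\to\mathbb{F}_2$. *)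

theory Defs
  imports "HOL-Computational_Algebra.Computational_Algebra" "HOL-Library.FuncSet" "HOL-Library.Cardinality"
begin

(* The absolute trace of a field with 2 ^ m elements, as the sum of the conjugates of x.
   Its values lie in the prime field {0, 1}, regarded as a subset of the field itself. *)
definition abs_trace :: "nat \<Rightarrow> 'a::field \<Rightarrow> 'a" where
  "abs_trace m x = (\<Sum>i<m. x ^ (2 ^ i))"

definition trace_one_set :: "nat \<Rightarrow> 'a::field set" where
  "trace_one_set m = {x. abs_trace m x = 1}"

(* Meaningful when squaring is a bijection, as on a finite field of characteristic 2. *)
definition field_sqrt :: "'a::field \<Rightarrow> 'a" where
  "field_sqrt x = (THE y. y ^ 2 = x)"

(* half_power x k stands for x raised to the power k / 2. *)
definition half_power :: "'a::field \<Rightarrow> int \<Rightarrow> 'a" where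
  "half_power x k = field_sqrt x powi k"

definition zero_one_map :: "nat \<Rightarrow> ('x \<Rightarrow> 'y) \<Rightarrow> 'x set \<Rightarrow> 'y set \<Rightarrow> bool" where
  "zero_one_map a F X Y \<longleftrightarrow>
     F \<in> X \<rightarrow> Y \<and> (\<forall>y\<in>Y. finite {x\<in>X. F x = y} \<and> card {x\<in>X. F x = y} \<in> {0, 1, a})"

definition Dstar :: "('a::field \<Rightarrow> 'a) \<Rightarrow> 'a set" where
  "Dstar f = f ` (UNIV - {0}) - {0}"

definition set_power :: "'a::field set \<Rightarrow> nat \<Rightarrow> 'a set" where
  "set_power D k = (\<lambda>d. d ^ k) ` D"

lemma square_eq_iff_field_sqrt:
  fixes x y :: "'a::finite_field"
  assumes "CARD('a) = 2 ^ m" "m > 0"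
  shows "y ^ 2 = x \<longleftrightarrow> y = x ^ (2 ^ (m - 1))"
proof -
  have e: "2 * 2 ^ (m - 1) = (2::nat) ^ m" using assms(2) by (cases m) auto
  have p: "z ^ (2 ^ m) = z" for z :: 'a using finite_field_power_card_eq_same[of z] assms(1) by simp
  show ?thesis
    by (metis e p power_mult mult.commute)
qed

lemma field_sqrt_eq:
  fixes x :: "'a::finite_field"
  assumes "CARD('a) = 2 ^ m" "m > 0"
  shows "field_sqrt x = x ^ (2 ^ (m - 1))"
  unfolding field_sqrt_def square_eq_iff_field_sqrt[OF assms] by simp

lemma half_power_even:
  fixes x :: "'a::finite_field"
  assumes "CARD('a) = 2 ^ m" "m > 0"
  shows "half_power x (2 * k) = x powi k"
proof -
  have "field_sqrt x ^ 2 = x"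
    using square_eq_iff_field_sqrt[OF assms] field_sqrt_eq[OF assms] by blast
  then show ?thesis
    by (simp add: half_power_def power_int_mult)
qed

end

theory Submission
  imports Defs
begin

text \<open>
  Write \<open>\<phi> x = x^\<sigma>\<close>. Since \<open>\<sigma>\<^sup>2 = 2^(m+1)\<close>, this is a field automorphism whose square is the
  Frobenius map, so that \<open>\<phi>\<close> sends \<open>s\<close> to \<open>z = \<phi> s\<close> and \<open>z\<close> to \<open>s\<^sup>2\<close>. The
  substitution \<open>x = s\<^sup>2\<close> removes the half-integer exponents: \<open>f (s\<^sup>2) = y\<close> becomes
  \<open>z (s\<^sup>2 + y) = s + 1\<close>. This relation and its \<open>\<phi>\<close>-conjugate express both \<open>y\<close> and \<open>\<phi> y\<close> as
  rational functions of \<open>s\<close> and \<open>z\<close>, and everything rests on identities between such functions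
  in characteristic 2.

  The central quantity is the resolvent \<open>W = \<phi> y * s (s\<^sup>2 + y)\<close>. With \<open>A = y^(\<sigma>+1)\<close> it satisfies
  three identities. First, \<open>W + \<phi> W + A = 1\<close>, and taking traces shows that every value \<open>y\<close> of \<open>f\<close>
  has \<open>Tr A = 1\<close>. Second, \<open>W\<^sup>2 + W = A (1 + y)\<close>, so for given \<open>y\<close> there are two candidates
  for \<open>W\<close>, differing by 1; as \<open>m\<close> is odd, \<open>Tr 1 = 1\<close> and the trace tells them apart. Third,
  \<open>Tr W = 1 + \<tau>\<close> where \<open>\<tau> = Tr (1 / (s z))\<close>. Hence two roots \<open>s\<close> for the same \<open>y\<close> with
  equal \<open>\<tau>\<close> have equal \<open>W\<close>, that is, they are roots of one cubic \<open>X (X\<^sup>2 + y) = c\<close>.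

  The remaining roots of that cubic are \<open>s b\<close> and \<open>s (b + 1)\<close>, where \<open>b\<close> solves the
  Artin--Schreier equation \<open>b\<^sup>2 + b = p + \<phi> p\<close>, \<open>p = 1 / (s z)\<close>. This has an explicit solution,
  the half-trace of \<open>p\<close>, which shows that \<open>\<phi> b = b + Tr p + p\<close> and decides whether a root
  of the cubic other than \<open>s\<close> solves the original equation: always if \<open>\<tau> = 0\<close>, never if
  \<open>\<tau> = 1\<close>.
  Each fibre therefore contains at most one root with \<open>\<tau> = 1\<close>, and either no root or exactly
  three roots with \<open>\<tau> = 0\<close>.

  Finally, \<open>s \<mapsto> s^(\<sigma>+1)\<close> permutes the field, so there are \<open>2^(m-1)\<close> elements \<open>s\<close> with
  \<open>\<tau> = 1\<close> and equally many \<open>y\<close> with \<open>Tr A = 1\<close>. The injection from the former to the latter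
  is a bijection: each \<open>y\<close> with \<open>Tr A = 1\<close> has exactly one root with \<open>\<tau> = 1\<close>, and so a fibre
  of size 1 or 4. The image of \<open>f\<close> is thus \<open>{y. Tr (y^(\<sigma>+1)) = 1}\<close>, which gives the other claims.
\<close>

section \<open>Fields of order an odd power of two\<close>

text \<open>
  The argument \<open>F\<close> only carries the type of the field.
\<close>
locale tits_field =
  fixes m :: nat and F :: "'a::finite_field itself"
  assumes odd_m: "odd m" and card_field: "CARD('a) = 2 ^ m"
begin

lemma power_card [simp]: "(x::'a) ^ (2 ^ m) = x"
  using finite_field_power_card_eq_same[of x] card_field by simp

text \<open>
  The characteristic is 2: \<open>-1\<close> equals its own power to the even exponent \<open>CARD('a)\<close>.
\<close>
lemma minus_eq [simp]: "- (x::'a) = x"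
proof -
  have "even ((2::nat) ^ m)"
    using odd_m by (cases m) auto
  then have "(- 1 :: 'a) ^ (2 ^ m) = 1"
    by (simp only: power_minus_even power_one)
  then have "(- 1 :: 'a) = 1"
    by (simp only: power_card)
  then have "(- 1) * x = x"
    by (simp only: mult_1_left)
  then show ?thesis
    by (simp only: mult_minus1)
qed

lemma add_self [simp]: "x + x = (0::'a)"
  by (metis add.right_inverse minus_eq)

lemma add_self_left [simp]: "x + (x + y) = (y::'a)"
  by (simp flip: add.assoc)

lemma diff_eq_add [simp]: "x - y = x + (y::'a)"
  by (metis diff_conv_add_uminus minus_eq)

lemma two_eq_zero [simp]: "(2::'a) = 0"
  using add_self[of 1] by (simp only: one_add_one)

lemma add_eq_0_iff_eq: "x + y = 0 \<longleftrightarrow> x = (y::'a)"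
  by (metis diff_eq_add right_minus_eq)

lemma power2_add: "(x + y) ^ 2 = x ^ 2 + (y::'a) ^ 2"
  by (simp add: power2_sum)

lemma power_two_power_add: "(x + y) ^ (2 ^ k) = x ^ (2 ^ k) + (y::'a) ^ (2 ^ k)"
  by (induction k) (simp_all add: power_mult power2_add mult.commute[of 2])

lemma power2_eq_iff_eq [simp]: "x ^ 2 = y ^ 2 \<longleftrightarrow> x = (y::'a)"
  by (metis add_eq_0_iff_eq power2_add zero_eq_power2)

section \<open>A square root of the Frobenius automorphism\<close>

definition \<phi> :: "'a \<Rightarrow> 'a" where
  "\<phi> x = x ^ (2 ^ ((m + 1) div 2))"

lemma phi_add: "\<phi> (x + y) = \<phi> x + \<phi> y"
  and phi_mult: "\<phi> (x * y) = \<phi> x * \<phi> y"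
  and phi_divide: "\<phi> (x / y) = \<phi> x / \<phi> y"
  and phi_power: "\<phi> (x ^ k) = \<phi> x ^ k"
  and phi_0 [simp]: "\<phi> 0 = 0"
  and phi_1 [simp]: "\<phi> 1 = 1"
  and phi_eq_0_iff [simp]: "\<phi> x = 0 \<longleftrightarrow> x = 0"
  by (simp_all add: \<phi>_def power_two_power_add power_mult_distrib power_divide mult.commute
      flip: power_mult)

lemma phi_phi: "\<phi> (\<phi> x) = x ^ 2"
proof -
  have "\<phi> (\<phi> x) = x ^ (2 ^ ((m + 1) div 2 + (m + 1) div 2))"
    by (simp add: \<phi>_def power_add power_mult)
  also have "(m + 1) div 2 + (m + 1) div 2 = Suc m"
    using odd_m by presburger
  finally show ?thesis
    by (simp add: power_mult mult.commute)
qed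

lemmas phi_simps = phi_add phi_mult phi_divide phi_power phi_phi

section \<open>Trace and half-trace\<close>

abbreviation Tr :: "'a \<Rightarrow> 'a" where
  "Tr \<equiv> abs_trace m"

lemma trace_add: "Tr (x + y) = Tr x + Tr y"
  by (simp add: abs_trace_def power_two_power_add sum.distrib)

lemma trace_1 [simp]: "Tr 1 = 1"
proof -
  have "of_nat m = (1::'a)"
    using odd_m by (auto elim!: oddE)
  then show ?thesis
    by (simp add: abs_trace_def)
qed

lemma trace_0 [simp]: "Tr 0 = 0"
  by (simp add: abs_trace_def power_0_left)

lemma trace_power2: "Tr (x ^ 2) = Tr x"
proof -
  have "Tr (x ^ 2) = (\<Sum>i<m. x ^ (2 ^ Suc i))"
    by (simp add: abs_trace_def power_mult)
  also have "\<dots> + x = (\<Sum>i<Suc m. x ^ (2 ^ i))"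
    by (simp only: sum.lessThan_Suc_shift) (simp add: add.commute)
  also have "\<dots> = Tr x + x"
    by (simp add: abs_trace_def)
  finally show ?thesis
    by simp
qed

lemma trace_phi: "Tr (\<phi> x) = Tr x"
proof -
  have "Tr (x ^ (2 ^ k)) = Tr x" for k
    by (induction k) (simp_all add: power_mult trace_power2 mult.commute[of 2])
  then show ?thesis
    by (simp add: \<phi>_def)
qed

lemma sum_power2: "(\<Sum>i\<in>A. g i) ^ 2 = (\<Sum>i\<in>A. (g i :: 'a) ^ 2)"
  by (induction A rule: infinite_finite_induct) (simp_all add: power2_add)

lemma trace_eq_0_or_1: "Tr x = 0 \<or> Tr x = 1"
proof -
  have "Tr x ^ 2 = Tr (x ^ 2)"
    by (simp add: abs_trace_def sum_power2 mult.commute flip: power_mult)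
  then have "Tr x * (Tr x + 1) = 0"
    by (simp add: trace_power2 distrib_left flip: power2_eq_square)
  then show ?thesis
    using add_eq_0_iff_eq by auto
qed

text \<open>
  Since \<open>Tr 1 = 1\<close>, translation by 1 exchanges the two fibres of the trace.
\<close>
lemma card_trace_eq_1: "card {x. Tr x = 1} = 2 ^ (m - 1)"
proof -
  have "bij_betw (\<lambda>x. x + 1) {x. Tr x = 1} {x. Tr x = 0}"
    by (rule bij_betwI[where g = "\<lambda>x. x + 1"]) (auto simp: trace_add add.assoc)
  then have eq: "card {x. Tr x = 1} = card {x. Tr x = 0}"
    by (rule bij_betw_same_card)
  have "CARD('a) = card ({x. Tr x = 1} \<union> {x. Tr x = 0})"
    using trace_eq_0_or_1 by (intro arg_cong[where f = card]) auto
  also have "\<dots> = 2 * card {x. Tr x = 1}"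
    by (subst card_Un_disjoint) (auto simp: eq)
  finally show ?thesis
    using card_field odd_m by (cases m) auto
qed

text \<open>
  Half of the conjugates: for odd \<open>m\<close>, \<open>\<phi>\<close> carries these summands to the remaining ones, with
  the first conjugate occurring once more at the end, since \<open>2 ((m + 1) / 2) = m + 1\<close>.
\<close>
definition half_trace :: "'a \<Rightarrow> 'a" where
  "half_trace x = (\<Sum>i<(m + 1) div 2. x ^ (2 ^ i))"

text \<open>
  Squaring shifts the summands by one place, so the sum telescopes; this provides a root of
  the Artin--Schreier equation for every right-hand side of the form \<open>x + \<phi> x\<close>.
\<close>
lemma half_trace_artin_schreier: "half_trace x ^ 2 + half_trace x = x + \<phi> x"
proof -
  let ?n = "(m + 1) div 2"
  have "half_trace x ^ 2 + x = (\<Sum>i<?n. x ^ (2 ^ Suc i)) + x"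
    by (simp add: half_trace_def sum_power2 mult.commute flip: power_mult)
  also have "\<dots> = (\<Sum>i<Suc ?n. x ^ (2 ^ i))"
    by (simp only: sum.lessThan_Suc_shift) (simp add: add.commute)
  also have "\<dots> = half_trace x + \<phi> x"
    by (simp add: half_trace_def \<phi>_def)
  finally show ?thesis
    by (metis add.commute add.left_commute add_self_left)
qed

lemma phi_sum: "\<phi> (\<Sum>i\<in>A. g i) = (\<Sum>i\<in>A. \<phi> (g i))"
  by (induction A rule: infinite_finite_induct) (simp_all add: phi_add)

lemma half_trace_phi: "\<phi> (half_trace x) + half_trace x = Tr x + x"
proof -
  let ?n = "(m + 1) div 2"
  have n: "?n + ?n = Suc m"
    using odd_m by presburger
  have "\<phi> (half_trace x) = (\<Sum>i<?n. x ^ (2 ^ (i + ?n)))"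
    by (simp add: half_trace_def phi_sum) (simp add: \<phi>_def power_add power_mult)
  also have "\<dots> = (\<Sum>i\<in>{?n..<?n + ?n}. x ^ (2 ^ i))"
    using sum.shift_bounds_nat_ivl[of "\<lambda>i. x ^ (2 ^ i)" 0 ?n ?n]
    by (simp add: lessThan_atLeast0)
  also have "half_trace x + \<dots> = (\<Sum>i\<in>{0..<?n + ?n}. x ^ (2 ^ i))"
    unfolding half_trace_def lessThan_atLeast0 by (rule sum.atLeastLessThan_concat) auto
  also have "\<dots> = Tr x + x"
    unfolding n by (simp add: abs_trace_def lessThan_atLeast0)
  finally show ?thesis
    by (simp add: add.commute)
qed

lemma artin_schreier_roots:
  assumes "b ^ 2 + b = c ^ 2 + (c::'a)"
  shows "b = c \<or> b = c + 1"
proof -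
  have "(b + c) * (b + c + 1) = (b ^ 2 + b) + (c ^ 2 + c)"
    by (simp add: algebra_simps power2_eq_square)
  then have "b + c = 0 \<or> b + c + 1 = 0"
    using assms by simp
  then show ?thesis
    by (metis add.left_commute add_eq_0_iff_eq add.commute)
qed

text \<open>
  Both roots of the equation, the half-trace of \<open>x\<close> and its translate by 1, are changed by the
  same amount under \<open>\<phi>\<close>, because \<open>\<phi>\<close> fixes 1.
\<close>
lemma phi_artin_schreier:
  assumes "b ^ 2 + b = x + \<phi> x"
  shows "\<phi> b = b + Tr x + x"
proof -
  have "\<phi> b + b = \<phi> (half_trace x) + half_trace x"
    using artin_schreier_roots[of b "half_trace x"] assms half_trace_artin_schreier[of x]
    by (auto simp: phi_add algebra_simps)
  then have "\<phi> b + b = Tr x + x"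
    by (simp add: half_trace_phi)
  then show ?thesis
    by (metis add.commute add.left_commute add_self_left)
qed

section \<open>The permutation with exponent \<open>\<sigma> + 1\<close>\<close>

definition norm_map :: "'a \<Rightarrow> 'a" where
  "norm_map x = x * \<phi> x"

lemma norm_map_eq_0_iff [simp]: "norm_map x = 0 \<longleftrightarrow> x = 0"
  by (simp add: norm_map_def)

text \<open>
  A nonzero \<open>x\<close> is recovered from \<open>N = x \<phi> x\<close> as \<open>\<phi> N / N\<close>, since \<open>\<phi> N = x\<^sup>2 \<phi> x\<close>.
\<close>
lemma inj_norm_map: "inj norm_map"
proof (rule injI)
  fix x y
  assume eq: "norm_map x = norm_map y"
  show "x = y"
  proof (cases "norm_map x = 0")
    case False
    have "\<phi> (norm_map z) = z * norm_map z" for z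
      by (simp add: norm_map_def phi_simps power2_eq_square algebra_simps)
    then have "x * norm_map x = y * norm_map x"
      by (metis eq)
    with False show ?thesis
      by simp
  next
    case True
    with eq have "norm_map y = 0"
      by simp
    with True show ?thesis
      by simp
  qed
qed

lemma surj_norm_map: "\<exists>x. norm_map x = t"
  using finite_UNIV_inj_surj[OF finite inj_norm_map] by (metis surjD)

lemma bij_betw_norm_map: "bij_betw norm_map {x. P (norm_map x)} {t. P t}"
proof (rule bij_betw_imageI)
  show "inj_on norm_map {x. P (norm_map x)}"
    using inj_norm_map by (rule inj_on_subset) simp
  show "norm_map ` {x. P (norm_map x)} = {t. P t}"
  proof (intro equalityI subsetI)
    fix t
    assume "t \<in> {t. P t}"
    moreover obtain x where "t = norm_map x"
      using surj_norm_map by metis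
    ultimately show "t \<in> norm_map ` {x. P (norm_map x)}"
      by simp
  qed auto
qed

section \<open>The resolvent of a root\<close>

definition \<tau> :: "'a \<Rightarrow> 'a" where
  "\<tau> s = Tr (1 / (s * \<phi> s))"

text \<open>
  The equation \<open>f (s\<^sup>2) = y\<close> with its denominator \<open>\<phi> s\<close> cleared. Clearing it adds no
  solution at \<open>s = 0\<close>, where the two sides are 0 and 1.
\<close>
definition fibre_root :: "'a \<Rightarrow> 'a \<Rightarrow> bool" where
  "fibre_root y s \<longleftrightarrow> \<phi> s * (s ^ 2 + y) = s + 1"

lemma fibre_root_nonzero: "fibre_root y s \<Longrightarrow> s \<noteq> 0"
  by (auto simp: fibre_root_def)

text \<open>
  The value at \<open>s\<close> of the cubic \<open>X (X\<^sup>2 + y)\<close>, scaled by \<open>\<phi> y\<close> so that the quadratic equation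
  that it satisfies over \<open>y\<close> takes Artin--Schreier form.
\<close>
definition resolvent :: "'a \<Rightarrow> 'a \<Rightarrow> 'a" where
  "resolvent y s = \<phi> y * (s * (s ^ 2 + y))"

text \<open>
  The second formula is the image of the first under \<open>\<phi>\<close>: \<open>\<phi>\<close> sends \<open>s\<close> to \<open>\<phi> s\<close> and
  \<open>\<phi> s\<close> to \<open>s\<^sup>2\<close>.
\<close>
lemma fibre_root_explicit:
  assumes "fibre_root y s"
  shows "y = (s + 1) / \<phi> s + s ^ 2" "\<phi> y = (\<phi> s + 1) / s ^ 2 + \<phi> s ^ 2"
proof -
  have s: "\<phi> s \<noteq> 0"
    using fibre_root_nonzero[OF assms] by simp
  have "s ^ 2 + y = (s + 1) / \<phi> s"
    using assms s by (simp add: fibre_root_def field_simps)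
  then show y: "y = (s + 1) / \<phi> s + s ^ 2"
    by (metis add.commute add_self_left)
  show "\<phi> y = (\<phi> s + 1) / s ^ 2 + \<phi> s ^ 2"
    by (subst y) (simp add: phi_simps)
qed

lemma resolvent_explicit:
  assumes "fibre_root y s"
  shows "resolvent y s = 1 + 1 / s + 1 / \<phi> s + 1 / (s * \<phi> s) + \<phi> s * s ^ 2 + \<phi> s * s"
proof -
  have "s ^ 2 + y = (s + 1) / \<phi> s"
    by (subst fibre_root_explicit[OF assms]) (simp add: add.commute)
  then have "resolvent y s = ((\<phi> s + 1) / s ^ 2 + \<phi> s ^ 2) * (s * ((s + 1) / \<phi> s))"
    by (simp only: resolvent_def fibre_root_explicit(2)[OF assms])
  also have "\<dots> = 1 + 1 / s + 1 / \<phi> s + 1 / (s * \<phi> s) + \<phi> s * s ^ 2 + \<phi> s * s"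
    using fibre_root_nonzero[OF assms] by (simp add: field_simps power2_eq_square)
  finally show ?thesis .
qed

text \<open>
  In the explicit formula the terms \<open>1 / s\<close> and \<open>1 / \<phi> s\<close> are conjugate, and so are
  \<open>\<phi> s * s\<close> and \<open>\<phi> s * s\<^sup>2\<close>; their traces cancel in pairs.
\<close>
lemma trace_resolvent:
  assumes "fibre_root y s"
  shows "Tr (resolvent y s) = 1 + \<tau> s"
proof -
  have "Tr (1 / \<phi> s) = Tr (1 / s)" "Tr (\<phi> s * s ^ 2) = Tr (\<phi> s * s)"
    using trace_phi[of "1 / s"] trace_phi[of "\<phi> s * s"] by (simp_all add: phi_simps mult.commute)
  then show ?thesis
    by (simp add: resolvent_explicit[OF assms] trace_add \<tau>_def algebra_simps)
qed

text \<open>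
  Both this identity and the next one are identities of rational functions in \<open>s\<close> and \<open>\<phi> s\<close>
  in characteristic 2, after all other quantities are eliminated by the explicit formulas.
\<close>
lemma resolvent_phi:
  assumes "fibre_root y s"
  shows "resolvent y s + \<phi> (resolvent y s) + norm_map y = 1"
proof -
  have nz: "s \<noteq> 0" "\<phi> s \<noteq> 0"
    using fibre_root_nonzero[OF assms] by auto
  show ?thesis
    unfolding resolvent_explicit[OF assms] norm_map_def fibre_root_explicit(2)[OF assms]
    apply (subst fibre_root_explicit(1)[OF assms])
    using nz by (simp add: phi_simps field_simps power2_eq_square)
qed

lemma resolvent_quadratic:
  assumes "fibre_root y s"
  shows "resolvent y s ^ 2 + resolvent y s = norm_map y * (1 + y)"
proof -
  have nz: "s \<noteq> 0" "\<phi> s \<noteq> 0"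
    using fibre_root_nonzero[OF assms] by auto
  show ?thesis
    unfolding resolvent_explicit[OF assms] norm_map_def fibre_root_explicit(2)[OF assms]
    apply (subst (1 2) fibre_root_explicit(1)[OF assms])
    using nz by (simp add: phi_simps field_simps power2_eq_square)
qed

text \<open>
  The necessary condition for \<open>y\<close> to be a value of \<open>f\<close>: the traces of \<open>W\<close> and \<open>\<phi> W\<close> cancel
  in the identity \<open>W + \<phi> W + y \<phi> y = 1\<close>. It also excludes \<open>y = 0\<close>.
\<close>
lemma fibre_root_trace_norm_map:
  assumes "fibre_root y s"
  shows "Tr (norm_map y) = 1"
proof -
  have "Tr (resolvent y s + \<phi> (resolvent y s) + norm_map y) = 1"
    by (simp add: resolvent_phi[OF assms])
  then show ?thesis
    by (simp add: trace_add trace_phi)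
qed

section \<open>Roots with a common resolvent\<close>

text \<open>
  Writing a second element as \<open>s + s b\<close> and cancelling the known root \<open>b = 0\<close> from the cubic
  leaves a quadratic in \<open>b\<close>; by the equation for \<open>s\<close> its constant term is
  \<open>(s + 1) / (s\<^sup>2 \<phi> s) = p + \<phi> p\<close> with \<open>p = 1 / (s \<phi> s)\<close>.
\<close>
lemma resolvent_translate_iff:
  assumes "fibre_root y s" "b \<noteq> 0"
  shows "resolvent y (s + s * b) = resolvent y s \<longleftrightarrow> b ^ 2 + b = 1 / (s * \<phi> s) + \<phi> (1 / (s * \<phi> s))"
proof -
  have s: "s \<noteq> 0" "\<phi> s \<noteq> 0"
    using fibre_root_nonzero[OF assms(1)] by auto
  have "s ^ 2 + y = (s + 1) / \<phi> s"
    by (subst fibre_root_explicit[OF assms(1)]) (simp add: add.commute)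
  also have "\<dots> = s ^ 2 * (1 / (s * \<phi> s) + \<phi> (1 / (s * \<phi> s)))"
    using s by (simp add: phi_simps field_simps power2_eq_square)
  finally have c: "s ^ 2 + y = s ^ 2 * (1 / (s * \<phi> s) + \<phi> (1 / (s * \<phi> s)))" .
  have "resolvent y (s + s * b) + resolvent y s = \<phi> y * (s * b) * (s ^ 2 * (b ^ 2 + b) + (s ^ 2 + y))"
    by (simp add: resolvent_def algebra_simps power2_eq_square)
  moreover have "\<phi> y * (s * b) \<noteq> 0"
    using fibre_root_trace_norm_map[OF assms(1)] s assms(2) by (auto simp: norm_map_def)
  ultimately have "resolvent y (s + s * b) = resolvent y s \<longleftrightarrow> s ^ 2 * (b ^ 2 + b) = s ^ 2 + y"
    using add_eq_0_iff_eq by (metis mult_eq_0_iff)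
  then show ?thesis
    unfolding c using s by simp
qed

text \<open>
  Another root \<open>s + s b\<close> of the cubic need not solve the original equation. Its defect
  there is computed by means of \<open>\<phi> b = b + \<tau> s + p\<close>, and equals \<open>\<phi> s * s\<^sup>2 * \<tau> s * b\<close>.
\<close>
lemma fibre_root_translate_iff:
  assumes "fibre_root y s" and b: "b ^ 2 + b = 1 / (s * \<phi> s) + \<phi> (1 / (s * \<phi> s))"
  shows "fibre_root y (s + s * b) \<longleftrightarrow> \<tau> s = 0 \<or> b = 0"
proof -
  have nz: "s \<noteq> 0" "\<phi> s \<noteq> 0"
    using fibre_root_nonzero[OF assms(1)] by auto
  have phi_b: "\<phi> b = b + \<tau> s + 1 / (s * \<phi> s)"
    using phi_artin_schreier[OF b] by (simp add: \<tau>_def)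
  have sq: "(s + s * b) ^ 2 = s ^ 2 + s ^ 2 * (b + 1 / (s * \<phi> s) + 1 / (\<phi> s * s ^ 2))"
  proof -
    have "b ^ 2 = b + (b ^ 2 + b)"
      by (simp add: add.left_commute)
    also have "\<dots> = b + 1 / (s * \<phi> s) + 1 / (\<phi> s * s ^ 2)"
      unfolding b by (simp add: phi_simps add.assoc)
    finally show ?thesis
      by (simp only: power2_add power_mult_distrib)
  qed
  have "\<phi> (s + s * b) * ((s + s * b) ^ 2 + y) + (s + s * b + 1)
      = \<phi> s * s ^ 2 * (\<tau> s * b) + (\<phi> s * s ^ 2 * (b ^ 2 + b) + (s + 1))"
    unfolding sq phi_add phi_mult phi_b
    apply (subst fibre_root_explicit(1)[OF assms(1)])
    using nz by (simp add: field_simps power2_eq_square)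
  also have "\<phi> s * s ^ 2 * (b ^ 2 + b) = s + 1"
    unfolding b using nz by (simp add: phi_simps field_simps power2_eq_square)
  finally have "\<phi> (s + s * b) * ((s + s * b) ^ 2 + y) + (s + s * b + 1)
      = \<phi> s * s ^ 2 * (\<tau> s * b)"
    by simp
  then show ?thesis
    unfolding fibre_root_def by (subst add_eq_0_iff_eq[symmetric]) (use nz in auto)
qed

text \<open>
  Over one \<open>y\<close> the resolvent is known up to adding 1, and its trace is \<open>1 + \<tau>\<close>. As
  \<open>Tr 1 = 1\<close>, equal \<open>\<tau>\<close> forces equal resolvents.
\<close>
lemma fibre_root_same_tau:
  assumes "fibre_root y s" "fibre_root y s'" "\<tau> s = \<tau> s'" "s \<noteq> s'"
  obtains b where "s' = s + s * b" "b \<noteq> 0"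
    "b ^ 2 + b = 1 / (s * \<phi> s) + \<phi> (1 / (s * \<phi> s))"
proof
  define b where "b = (s + s') / s"
  have s: "s \<noteq> 0"
    using fibre_root_nonzero[OF assms(1)] .
  then show s': "s' = s + s * b"
    by (simp add: b_def)
  show b: "b \<noteq> 0"
    using assms(4) s by (simp add: b_def add_eq_0_iff_eq)
  have "resolvent y s' = resolvent y s"
  proof -
    have "resolvent y s' ^ 2 + resolvent y s' = resolvent y s ^ 2 + resolvent y s"
      using resolvent_quadratic[OF assms(1)] resolvent_quadratic[OF assms(2)] by simp
    moreover have "Tr (resolvent y s') = Tr (resolvent y s)"
      using assms(1-3) by (simp add: trace_resolvent)
    ultimately show ?thesis
      using artin_schreier_roots[of "resolvent y s'" "resolvent y s"] by (auto simp: trace_add)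
  qed
  then show "b ^ 2 + b = 1 / (s * \<phi> s) + \<phi> (1 / (s * \<phi> s))"
    using resolvent_translate_iff[OF assms(1) b] s' by simp
qed

lemma tau_eq_0_or_1: "\<tau> s = 0 \<or> \<tau> s = 1"
  unfolding \<tau>_def by (rule trace_eq_0_or_1)

lemma fibre_root_tau_1_unique:
  assumes "fibre_root y s" "fibre_root y s'" "\<tau> s = 1" "\<tau> s' = 1"
  shows "s = s'"
proof (rule ccontr)
  assume "s \<noteq> s'"
  then obtain b where b: "s' = s + s * b" "b \<noteq> 0"
    "b ^ 2 + b = 1 / (s * \<phi> s) + \<phi> (1 / (s * \<phi> s))"
    using fibre_root_same_tau[OF assms(1,2)] assms(3,4) by metis
  then show False
    using fibre_root_translate_iff[OF assms(1) b(3)] assms(2,3) by simp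
qed

text \<open>
  One root \<open>s\<close> with \<open>\<tau> s = 0\<close> brings along the two other roots of its cubic, built from
  the half-trace \<open>h\<close> of \<open>1 / (s \<phi> s)\<close>. They are distinct from \<open>s\<close> and from each other:
  \<open>h\<close> is neither 0 nor 1 because \<open>s \<noteq> 1\<close>, the trace of 1 being 1.
\<close>
lemma card_fibre_root_tau_0: "card {s. fibre_root y s \<and> \<tau> s = 0} \<in> {0, 3}"
proof (cases "\<exists>s. fibre_root y s \<and> \<tau> s = 0")
  case True
  then obtain s where s: "fibre_root y s" "\<tau> s = 0"
    by auto
  define h where "h = half_trace (1 / (s * \<phi> s))"
  have h: "h ^ 2 + h = 1 / (s * \<phi> s) + \<phi> (1 / (s * \<phi> s))"
    unfolding h_def by (rule half_trace_artin_schreier)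
  then have h1: "(h + 1) ^ 2 + (h + 1) = 1 / (s * \<phi> s) + \<phi> (1 / (s * \<phi> s))"
    by (simp add: power2_add algebra_simps)
  have nz: "s \<noteq> 0" "\<phi> s \<noteq> 0"
    using fibre_root_nonzero[OF s(1)] by auto
  have "s \<noteq> 1"
    using s(2) by (auto simp: \<tau>_def)
  moreover have "s ^ 2 * \<phi> s * (h ^ 2 + h) = s + 1"
    unfolding h using nz by (simp add: phi_simps field_simps power2_eq_square)
  ultimately have "h ^ 2 + h \<noteq> 0"
    by (auto simp: add_eq_0_iff_eq)
  then have h01: "h \<noteq> 0" "h \<noteq> 1"
    by auto
  have translate: "fibre_root y (s + s * b) \<and> \<tau> (s + s * b) = 0"
    if b: "b ^ 2 + b = 1 / (s * \<phi> s) + \<phi> (1 / (s * \<phi> s))" "b \<noteq> 0" for b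
  proof -
    have "fibre_root y (s + s * b)"
      using fibre_root_translate_iff[OF s(1) b(1)] s(2) by simp
    moreover have "resolvent y (s + s * b) = resolvent y s"
      using resolvent_translate_iff[OF s(1) b(2)] b(1) by simp
    then have "1 + \<tau> (s + s * b) = 1 + \<tau> s"
      using trace_resolvent calculation s(1) by metis
    ultimately show ?thesis
      using s(2) by simp
  qed
  have "{s. fibre_root y s \<and> \<tau> s = 0} = {s, s + s * h, s + s * (h + 1)}"
  proof (intro equalityI subsetI)
    fix t
    assume "t \<in> {s. fibre_root y s \<and> \<tau> s = 0}"
    then have t: "fibre_root y t" "\<tau> s = \<tau> t"
      using s by auto
    show "t \<in> {s, s + s * h, s + s * (h + 1)}"
    proof (cases "s = t")
      case False
      obtain b where b: "t = s + s * b" "b \<noteq> 0"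
        "b ^ 2 + b = 1 / (s * \<phi> s) + \<phi> (1 / (s * \<phi> s))"
        using fibre_root_same_tau[OF s(1) t False] by metis
      with artin_schreier_roots[of b h] h show ?thesis
        by auto
    qed simp
  next
    fix t
    assume "t \<in> {s, s + s * h, s + s * (h + 1)}"
    then show "t \<in> {s. fibre_root y s \<and> \<tau> s = 0}"
      using s translate[OF h] translate[OF h1] h01 by (auto simp: add_eq_0_iff_eq)
  qed
  moreover have "card {s, s + s * h, s + s * (h + 1)} = 3"
    using h01 nz by (auto simp: card_insert_if add_eq_0_iff_eq distrib_left)
  ultimately show ?thesis
    by simp
qed auto

section \<open>Counting the fibres\<close>

text \<open>
  A root with \<open>\<tau> = 1\<close> is obtained by counting. The map \<open>g\<close> sends \<open>s \<noteq> 0\<close> to the only \<open>y\<close>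
  for which it is a root; it is injective on the \<open>s\<close> with \<open>\<tau> s = 1\<close>, and through
  the permutation \<open>norm_map\<close> these are as many as the elements \<open>y\<close> in question.
\<close>
lemma fibre_root_tau_1_exists:
  assumes "Tr (norm_map y) = 1"
  shows "\<exists>s. fibre_root y s \<and> \<tau> s = 1"
proof -
  define U where "U = {s. s \<noteq> 0 \<and> \<tau> s = 1}"
  define V where "V = {y. Tr (norm_map y) = 1}"
  define g where "g s = (s + 1) / \<phi> s + s ^ 2" for s
  have sol: "fibre_root (g s) s" if "s \<in> U" for s
  proof -
    have "s ^ 2 + g s = (s + 1) / \<phi> s"
      unfolding g_def by (metis add.commute add_self_left)
    then show ?thesis
      using that by (simp add: U_def fibre_root_def)
  qed
  have "bij_betw norm_map V {t. Tr t = 1}"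
    unfolding V_def by (rule bij_betw_norm_map)
  then have "card V = card {t. Tr t = 1}"
    by (rule bij_betw_same_card)
  moreover have "bij_betw norm_map U {t. Tr (1 / t) = 1}"
  proof -
    have "U = {s. Tr (1 / norm_map s) = 1}"
      by (auto simp: U_def \<tau>_def norm_map_def)
    then show ?thesis
      using bij_betw_norm_map[of "\<lambda>t. Tr (1 / t) = 1"] by simp
  qed
  then have "card U = card {t. Tr (1 / t) = 1}"
    by (rule bij_betw_same_card)
  moreover have "card {t. Tr (1 / t) = 1} = card {t. Tr t = 1}"
    by (rule bij_betw_same_card[OF bij_betwI[of "\<lambda>t. 1 / t" _ _ "\<lambda>t. 1 / t"]]) auto
  moreover have "inj_on g U"
  proof (rule inj_onI)
    fix s s'
    assume "s \<in> U" "s' \<in> U" "g s = g s'"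
    then show "s = s'"
      using sol[of s] sol[of s'] by (intro fibre_root_tau_1_unique[of "g s" s s']) (simp_all add: U_def)
  qed
  moreover have "g ` U \<subseteq> V"
    using sol fibre_root_trace_norm_map unfolding V_def by blast
  ultimately have "g ` U = V"
    by (intro card_subset_eq) (simp_all add: card_image)
  moreover have "y \<in> V"
    using assms by (simp add: V_def)
  ultimately obtain s where "s \<in> U" "y = g s"
    by blast
  then have "fibre_root y s \<and> \<tau> s = 1"
    using sol by (simp add: U_def)
  then show ?thesis ..
qed

lemma card_fibre_root:
  assumes "Tr (norm_map y) = 1"
  shows "card {s. fibre_root y s} \<in> {1, 4}"
proof -
  obtain s where s: "fibre_root y s" "\<tau> s = 1"
    using fibre_root_tau_1_exists[OF assms] by blast
  have "{s. fibre_root y s} = insert s {s. fibre_root y s \<and> \<tau> s = 0}"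
    using s fibre_root_tau_1_unique[OF _ s(1) _ s(2)] tau_eq_0_or_1 by blast
  moreover have "s \<notin> {s. fibre_root y s \<and> \<tau> s = 0}"
    using s by simp
  ultimately have "card {s. fibre_root y s} = Suc (card {s. fibre_root y s \<and> \<tau> s = 0})"
    by simp
  then show ?thesis
    using card_fibre_root_tau_0[of y] by auto
qed

lemma ex_fibre_root_iff: "(\<exists>s. fibre_root y s) \<longleftrightarrow> Tr (norm_map y) = 1"
  using fibre_root_trace_norm_map fibre_root_tau_1_exists by blast

text \<open>
  Every element is a square in exactly one way, so \<open>x = s\<^sup>2\<close> turns the fibres of \<open>f\<close> into
  solution sets of a polynomial relation between \<open>s\<close> and \<open>\<phi> s\<close>.
\<close>
lemma bij_betw_fibre:
  assumes f: "\<And>x. x \<noteq> 0 \<Longrightarrow>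
      f x = half_power x (- int (2 ^ ((m + 1) div 2)))
        + half_power x (- (int (2 ^ ((m + 1) div 2)) - 1)) + x"
  shows "bij_betw (\<lambda>s. s ^ 2) {s. fibre_root y s} {x \<in> UNIV - {0}. f x = y}"
proof -
  have m: "m > 0"
    using odd_m by (auto elim: oddE)
  have f_square: "f (s ^ 2) = (s + 1) / \<phi> s + s ^ 2" if s: "s \<noteq> 0" for s
  proof -
    have "field_sqrt (s ^ 2) = s"
      using square_eq_iff_field_sqrt[OF card_field m, of s "s ^ 2"] field_sqrt_eq[OF card_field m]
      by simp
    moreover have "s powi int (2 ^ ((m + 1) div 2)) = \<phi> s"
      unfolding \<phi>_def by (rule power_int_of_nat)
    moreover have "s powi (- (int (2 ^ ((m + 1) div 2)) - 1)) = s / s powi int (2 ^ ((m + 1) div 2))"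
      using s power_int_diff[of s 1 "int (2 ^ ((m + 1) div 2))"] by simp
    ultimately show ?thesis
      using s by (simp add: f half_power_def power_int_minus add_divide_distrib divide_inverse
          add.commute distrib_right del: of_nat_power)
  qed
  have root_iff: "fibre_root y s \<longleftrightarrow> f (s ^ 2) = y" if s: "s \<noteq> 0" for s
  proof -
    have "fibre_root y s \<longleftrightarrow> (s + 1) / \<phi> s = s ^ 2 + y"
      using s by (auto simp: fibre_root_def field_simps)
    also have "\<dots> \<longleftrightarrow> f (s ^ 2) = y"
      unfolding f_square[OF s] by (metis add.commute add_self_left)
    finally show ?thesis .
  qed
  show ?thesis
  proof (rule bij_betw_imageI)
    show "inj_on (\<lambda>s. s ^ 2) {s. fibre_root y s}"
      by (simp add: inj_on_def)
    show "(\<lambda>s. s ^ 2) ` {s. fibre_root y s} = {x \<in> UNIV - {0}. f x = y}"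
    proof (intro equalityI subsetI)
      fix x
      assume x: "x \<in> {x \<in> UNIV - {0}. f x = y}"
      obtain s where "x = s ^ 2"
        using square_eq_iff_field_sqrt[OF card_field m] by metis
      then show "x \<in> (\<lambda>s. s ^ 2) ` {s. fibre_root y s}"
        using x root_iff[of s] by auto
    qed (use root_iff fibre_root_nonzero in auto)
  qed
qed

end

theorem theorem21:
  fixes m \<sigma> :: nat and f :: "'a::finite_field \<Rightarrow> 'a"
  assumes "odd m"
    and "CARD('a) = 2 ^ m"
    and "\<sigma> = 2 ^ ((m + 1) div 2)"
    and "\<And>x. x \<noteq> 0 \<Longrightarrow>
           f x = half_power x (- int \<sigma>) + half_power x (- (int \<sigma> - 1)) + x"
  shows "zero_one_map 4 f (UNIV - {0}) UNIV
         \<and> set_power (Dstar f) (\<sigma> + 1) = trace_one_set m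
         \<and> card (Dstar f) = 2 ^ (m - 1)"
proof -
  interpret tits_field m "TYPE('a)"
    using assms(1,2) by unfold_locales
  have fibre: "bij_betw (\<lambda>s. s ^ 2) {s. fibre_root y s} {x \<in> UNIV - {0}. f x = y}" for y
    using assms(4) unfolding assms(3) by (rule bij_betw_fibre)
  have card_fibre: "card {x \<in> UNIV - {0}. f x = y} = card {s. fibre_root y s}" for y
    using bij_betw_same_card[OF fibre] by (rule sym)
  have "card {s. fibre_root y s} \<in> {0, 1, 4}" for y
  proof (cases "Tr (norm_map y) = 1")
    case True
    then show ?thesis
      using card_fibre_root by blast
  next
    case False
    then have "{s. fibre_root y s} = {}"
      using ex_fibre_root_iff[of y] by simp
    then show ?thesis
      by simp
  qed
  then have fibres: "zero_one_map 4 f (UNIV - {0}) UNIV"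
    unfolding zero_one_map_def card_fibre by simp
  have image_f: "y \<in> f ` (UNIV - {0}) \<longleftrightarrow> Tr (norm_map y) = 1" for y
  proof -
    have "y \<in> f ` (UNIV - {0}) \<longleftrightarrow> {x \<in> UNIV - {0}. f x = y} \<noteq> {}"
      by blast
    also have "\<dots> \<longleftrightarrow> (\<exists>s. fibre_root y s)"
      unfolding bij_betw_imp_surj_on[OF fibre, symmetric] by blast
    also have "\<dots> \<longleftrightarrow> Tr (norm_map y) = 1"
      by (rule ex_fibre_root_iff)
    finally show ?thesis .
  qed
  have Dstar: "Dstar f = {y. Tr (norm_map y) = 1}"
  proof -
    have "Tr (norm_map 0) \<noteq> 1"
      by (simp add: norm_map_def)
    then show ?thesis
      unfolding Dstar_def using image_f by blast
  qed
  have power: "(\<lambda>y. y ^ (\<sigma> + 1)) = norm_map"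
    by (simp add: fun_eq_iff norm_map_def \<phi>_def assms(3))
  have bij: "bij_betw norm_map (Dstar f) (trace_one_set m)"
    unfolding Dstar trace_one_set_def by (rule bij_betw_norm_map)
  then have "card (Dstar f) = card (trace_one_set m :: 'a set)"
    by (rule bij_betw_same_card)
  then have "card (Dstar f) = 2 ^ (m - 1)"
    using card_trace_eq_1 by (simp add: trace_one_set_def)
  with fibres bij show ?thesis
    unfolding set_power_def power by (simp add: bij_betw_def)
qed

end
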